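(* Let $n\geq 1$, let $Y \subset \mathbb{R}^n$ be a nonempty closed convex set, let $\gamma:\mathbb{R}^n\to\mathbb{R}$ be a concave continuous function, and let $J:\mathbb{R}^n \to \mathbb{R}$ be a Fréchet differentiable function satisfying the following conditions: (a) $\lim_{\|x\|\to+\infty} J(x) =+\infty$; (b) $\nabla J$ is Lipschitzian on $\mathbb{R}^n$, with Lipschitz constant $L$. Define $f(x,y):= J(x+y)-\frac{L}{2}\|y\|^2+\gamma(y)$ for $x,y\in\mathbb{R}^n$. Then $$\inf_{x\in \mathbb{R}^n} J(x) +\sup_{y\in Y}\left(-\frac{L}{2}\|y\|^2+\gamma(y)\right)= \inf_{x\in \mathbb{R}^n}\, \sup_{y\in Y} \left(J(x+y)-\frac{L}{2}\|y\|^2+\gamma(y)\right),$$ which is equivalent to $$\sup_{y\in Y}\,\inf_{x\in\mathbb{R}^n}f(x,y)=\inf_{x\in \mathbb{R}^n}\,\sup_{y\in Y}f(x,y).$$ In addition, $f$ admits a saddle point, that is, there exists a point $(\bar{x},\bar{y})\in \mathbb{R}^n\times Y$ such that $$f(\bar{x},y) \leq f(\bar{x},\bar{y})\leq f(x,\bar{y})\quad\text{for all } (x,y)\in \mathbb{R}^n\times Y.$$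
   Context: $\|\cdot\|$ is the Euclidean norm on $\mathbb{R}^n$. "$\nabla J$ is Lipschitzian with Lipschitz constant $L$" means $\|\nabla J(x)-\nabla J(x')\|\leq L\|x-x'\|$ for all $x,x'\in\mathbb{R}^n$. Suprema and infima are taken in the extended real line $[-\infty,+\infty]$. *)

theory Defs
  imports "HOL-Analysis.Analysis"
begin

text \<open>
  The gradient vector, i.e. the Riesz representative of the Frechet derivative.
  Meaningful only at points of differentiability, where it exists and is unique
  (\<open>gradient_works\<close>, \<open>gradient_unique\<close>).
\<close>
definition gradient :: "('a::euclidean_space \<Rightarrow> real) \<Rightarrow> 'a \<Rightarrow> 'a" where
  "gradient J x = (THE D. GDERIV J x :> D)"

lemma gradient_unique:
  fixes J :: "'a::euclidean_space \<Rightarrow> real"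
  assumes "GDERIV J x :> D"
  shows "gradient J x = D"
proof -
  have "E = D" if "GDERIV J x :> E" for E
  proof -
    have "(\<lambda>h. h \<bullet> E) = (\<lambda>h. h \<bullet> D)"
      using that assms unfolding gderiv_def by (rule has_derivative_unique)
    then have "\<forall>h. h \<bullet> E = h \<bullet> D"
      by (rule fun_cong[THEN allI])
    then show ?thesis
      by (simp only: vector_eq_ldot vector_eq_rdot)
  qed
  with assms show ?thesis
    unfolding gradient_def by (rule the_equality)
qed

lemma gradient_works:
  fixes J :: "'a::euclidean_space \<Rightarrow> real"
  assumes "J differentiable (at x)"
  shows "GDERIV J x :> gradient J x"
proof -
  from assms obtain J' where J': "(J has_derivative J') (at x)"
    unfolding differentiable_def by blast
  then have lin: "linear J'"
    by (rule has_derivative_linear)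
  have "(\<lambda>h. h \<bullet> adjoint J' 1) = J'"
    by (rule ext) (simp add: adjoint_works[OF lin])
  with J' have "GDERIV J x :> adjoint J' 1"
    unfolding gderiv_def by simp
  then show ?thesis
    by (simp add: gradient_unique)
qed

end

theory Submission
  imports Defs
begin

text \<open>
  Write \<open>g y = - (L / 2) * (norm y)\<^sup>2 + \<gamma> y\<close>, so that \<open>f x y = J (x + y) + g y\<close>.
  The saddle point is explicit: let \<open>z\<close> minimize \<open>J\<close>, let \<open>yb\<close> maximize \<open>g\<close> over \<open>Y\<close>, and
  put \<open>xb = z - yb\<close>. Since \<open>xb + yb = z\<close>, the inequality \<open>f xb yb \<le> f x yb\<close> is just
  minimality of \<open>z\<close>. For the other inequality two quadratic estimates with the same constant
  \<open>L / 2\<close> cancel: moving from \<open>z\<close> by \<open>d = y - yb\<close> raises \<open>J\<close> by at most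
  \<open>L / 2 * (norm d)\<^sup>2\<close>, because the gradient vanishes at \<open>z\<close> and is Lipschitz
  (\<open>Lipschitz_gradient_upper_bound\<close>), while \<open>g\<close>, being a concave function minus
  \<open>L / 2\<close> times the squared norm, loses at least that amount when leaving its maximizer on
  the convex set \<open>Y\<close> (\<open>strongly_concave_decay_from_maximizer\<close>).

  Both extrema exist by coercivity. For \<open>g\<close> this needs \<open>L > 0\<close>, which is a consequence of
  the hypotheses: for \<open>L \<le> 0\<close> the first estimate would make the minimum of \<open>J\<close> an upper
  bound of \<open>J\<close> as well. Then the quadratic term of \<open>g\<close> dominates \<open>\<gamma>\<close>, since a
  concave function grows at most linearly (\<open>concave_linear_growth\<close>). At a saddle point the lower
  and the upper value agree, and the common value \<open>J z + g yb\<close> is also the left-hand side of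
  the first identity.
\<close>

lemma coercive_attains_inf:
  fixes h :: "'a::euclidean_space \<Rightarrow> real"
  assumes "S \<noteq> {}" "closed S" "continuous_on S h" and coercive: "filterlim h at_top at_infinity"
  shows "\<exists>x\<in>S. \<forall>y\<in>S. h x \<le> h y"
proof -
  obtain a where a: "a \<in> S"
    using assms(1) by blast
  have "eventually (\<lambda>x. h x > h a) at_infinity"
    using coercive by (simp add: filterlim_at_top_dense)
  then obtain r where r: "\<And>x. norm x \<ge> r \<Longrightarrow> h x > h a"
    by (auto simp: eventually_at_infinity)
  have a_in: "a \<in> S \<inter> cball 0 r"
    using a r[of a] by fastforce
  have "compact (S \<inter> cball 0 r)"
    using assms(2) by (intro closed_Int_compact compact_cball)
  moreover have "continuous_on (S \<inter> cball 0 r) h"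
    using assms(3) by (rule continuous_on_subset) blast
  ultimately obtain x where x: "x \<in> S \<inter> cball 0 r" "\<And>y. y \<in> S \<inter> cball 0 r \<Longrightarrow> h x \<le> h y"
    using a_in continuous_attains_inf[of "S \<inter> cball 0 r" h] by blast
  have "h x \<le> h y" if "y \<in> S" for y
  proof (cases "norm y \<le> r")
    case True
    with that x(2) show ?thesis by simp
  next
    case False
    with r[of y] x(2)[OF a_in] show ?thesis by simp
  qed
  with x(1) show ?thesis by blast
qed

text \<open>
  The restriction of \<open>J\<close> to the segment from \<open>z\<close> to \<open>z + d\<close> has slope at most
  \<open>L * t * (norm d)\<^sup>2\<close> at parameter \<open>t\<close>, by the Lipschitz bound relative to the
  vanishing gradient at \<open>z\<close>. The sign of \<open>L\<close> is left open so that the estimate can serve to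
  prove that \<open>L\<close> is positive.
\<close>
lemma Lipschitz_gradient_upper_bound:
  fixes J :: "'a::euclidean_space \<Rightarrow> real"
  assumes diff: "\<And>x. J differentiable (at x)"
    and Lip: "\<And>x x'. norm (gradient J x - gradient J x') \<le> L * norm (x - x')"
    and min: "\<And>x. J z \<le> J x"
  shows "J (z + d) \<le> J z + L / 2 * (norm d)\<^sup>2"
proof -
  have grad: "(J has_derivative (\<lambda>h. h \<bullet> gradient J x)) (at x)" for x
    using gradient_works[OF diff] by (simp add: gderiv_def)
  have "(\<lambda>h. h \<bullet> gradient J z) = (\<lambda>h. 0)"
    using min by (intro differential_zero_maxmin[OF _ open_UNIV grad]) auto
  then have grad_z: "gradient J z = 0"
    by (metis inner_eq_zero_iff)
  define \<psi> where "\<psi> t = J (z + t *\<^sub>R d) - L / 2 * t\<^sup>2 * (norm d)\<^sup>2" for t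
  have "\<psi> 1 \<le> \<psi> 0"
  proof (rule DERIV_nonpos_imp_nonincreasing[OF zero_le_one])
    fix t :: real
    assume t: "0 \<le> t" "t \<le> 1"
    let ?slope = "d \<bullet> gradient J (z + t *\<^sub>R d) - L * t * (norm d)\<^sup>2"
    have "((\<lambda>t. z + t *\<^sub>R d) has_derivative (\<lambda>h. h *\<^sub>R d)) (at t)"
      by (auto intro!: derivative_eq_intros)
    from has_derivative_compose[OF this grad]
    have "((\<lambda>t. J (z + t *\<^sub>R d)) has_real_derivative d \<bullet> gradient J (z + t *\<^sub>R d)) (at t)"
      by (simp add: has_field_derivative_def mult.commute[of _ "d \<bullet> _"])
    then have "(\<psi> has_real_derivative ?slope) (at t)"
      unfolding \<psi>_def by (auto intro!: derivative_eq_intros)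
    moreover have "d \<bullet> gradient J (z + t *\<^sub>R d) \<le> norm d * norm (gradient J (z + t *\<^sub>R d))"
      by (rule norm_cauchy_schwarz)
    moreover have "norm (gradient J (z + t *\<^sub>R d)) \<le> L * (t * norm d)"
      using Lip[of "z + t *\<^sub>R d" z] grad_z t(1) by simp
    then have "norm d * norm (gradient J (z + t *\<^sub>R d)) \<le> norm d * (L * (t * norm d))"
      by (intro mult_left_mono) auto
    ultimately show "\<exists>y. (\<psi> has_real_derivative y) (at t) \<and> y \<le> 0"
      by (intro exI[of _ ?slope]) (auto simp: power2_eq_square algebra_simps)
  qed
  then show ?thesis
    by (simp add: \<psi>_def)
qed

text \<open>
  Concavity on the segment from \<open>0\<close> to \<open>y\<close> bounds \<open>\<gamma> y\<close> by extrapolating linearly from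
  the values at the origin and on the unit sphere, where \<open>\<gamma>\<close> is bounded by compactness.
\<close>
lemma concave_linear_growth:
  fixes \<gamma> :: "'a::euclidean_space \<Rightarrow> real"
  assumes concave: "concave_on UNIV \<gamma>" and cont: "continuous_on UNIV \<gamma>"
  shows "\<exists>C. \<forall>y. norm y \<ge> 1 \<longrightarrow> \<gamma> y \<le> C * norm y"
proof -
  have "compact (\<gamma> ` sphere 0 1)"
    using continuous_on_subset[OF cont] by (intro compact_continuous_image) auto
  then obtain M where M: "\<And>u. norm u = 1 \<Longrightarrow> \<bar>\<gamma> u\<bar> \<le> M"
    by (force dest!: compact_imp_bounded simp: bounded_iff)
  have "\<gamma> y \<le> (M + \<bar>\<gamma> 0\<bar>) * norm y" if y: "norm y \<ge> 1" for y
  proof -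
    define s where "s = norm y"
    have s: "s \<ge> 1"
      using y by (simp add: s_def)
    have "\<gamma> ((1 - 1 / s) *\<^sub>R 0 + (1 / s) *\<^sub>R y) \<ge> (1 - 1 / s) * \<gamma> 0 + (1 / s) * \<gamma> y"
      using s by (intro concave_onD[OF concave]) auto
    moreover have "norm ((1 / s) *\<^sub>R y) = 1"
      using s by (auto simp: s_def)
    from M[OF this] have "\<gamma> ((1 / s) *\<^sub>R y) \<le> M"
      by linarith
    ultimately have "(1 - 1 / s) * \<gamma> 0 + (1 / s) * \<gamma> y \<le> M"
      by simp
    then have "s * ((1 - 1 / s) * \<gamma> 0 + (1 / s) * \<gamma> y) \<le> s * M"
      using s by (intro mult_left_mono) auto
    moreover have "s * ((1 - 1 / s) * \<gamma> 0 + (1 / s) * \<gamma> y) = (s - 1) * \<gamma> 0 + \<gamma> y"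
      using s by (simp add: field_simps)
    moreover have "(s - 1) * (- \<gamma> 0) \<le> (s - 1) * \<bar>\<gamma> 0\<bar>"
      using s by (intro mult_left_mono) auto
    ultimately show ?thesis
      by (simp add: s_def[symmetric] algebra_simps)
  qed
  then show ?thesis by blast
qed

lemma concave_minus_quadratic_coercive:
  fixes \<gamma> :: "'a::euclidean_space \<Rightarrow> real"
  assumes "concave_on UNIV \<gamma>" "continuous_on UNIV \<gamma>" and L: "L > 0"
  shows "filterlim (\<lambda>y. L / 2 * (norm y)\<^sup>2 - \<gamma> y) at_top at_infinity"
proof -
  obtain C where C: "\<And>y. norm y \<ge> 1 \<Longrightarrow> \<gamma> y \<le> C * norm y"
    using concave_linear_growth[OF assms(1,2)] by blast
  have "norm y \<le> L / 2 * (norm y)\<^sup>2 - \<gamma> y" if y: "norm y \<ge> max 1 (2 * (C + 1) / L)" for y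
  proof -
    \<comment> \<open>The threshold is where the slope \<open>L / 2 * norm y\<close> exceeds \<open>C\<close> by one.\<close>
    have "C + 1 \<le> L / 2 * norm y"
      using y L by (simp add: field_simps)
    then have "(C + 1) * norm y \<le> L / 2 * norm y * norm y"
      by (intro mult_right_mono) auto
    with C[of y] y show ?thesis
      by (simp add: power2_eq_square algebra_simps)
  qed
  then have "eventually (\<lambda>y. norm y \<le> L / 2 * (norm y)\<^sup>2 - \<gamma> y) at_infinity"
    unfolding eventually_at_infinity by blast
  with filterlim_norm_at_top show ?thesis
    by (rule filterlim_at_top_mono)
qed

text \<open>
  Concavity of \<open>\<gamma>\<close> together with the exact expansion of the squared norm along the segment
  towards \<open>y\<close> gives, at parameter \<open>t\<close>, a loss of at least
  \<open>(1 - t) * L / 2 * (norm (y - yb))\<^sup>2\<close>; letting \<open>t\<close> tend to \<open>0\<close> recovers the full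
  constant, which is what is needed to balance \<open>Lipschitz_gradient_upper_bound\<close>.
\<close>
lemma strongly_concave_decay_from_maximizer:
  fixes \<gamma> :: "'a::real_inner \<Rightarrow> real"
  assumes concave: "concave_on Y \<gamma>" and yb: "yb \<in> Y" and y: "y \<in> Y"
    and g: "\<And>y. g y = - (L / 2) * (norm y)\<^sup>2 + \<gamma> y"
    and max: "\<And>y. y \<in> Y \<Longrightarrow> g y \<le> g yb"
  shows "g y + L / 2 * (norm (y - yb))\<^sup>2 \<le> g yb"
proof -
  define q where "q = (norm (y - yb))\<^sup>2"
  have chord: "g y + L / 2 * (1 - t) * q \<le> g yb" if t: "0 < t" "t < 1" for t
  proof -
    let ?p = "(1 - t) *\<^sub>R yb + t *\<^sub>R y"
    have "convex Y"
      using concave by (rule concave_on_imp_convex)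
    then have "?p \<in> Y"
      using yb y t by (intro convexD) auto
    then have "g ?p \<le> g yb"
      by (rule max)
    moreover have "\<gamma> ?p \<ge> (1 - t) * \<gamma> yb + t * \<gamma> y"
      using yb y t by (intro concave_onD[OF concave]) auto
    moreover have "(norm ?p)\<^sup>2 = (1 - t) * (norm yb)\<^sup>2 + t * (norm y)\<^sup>2 - t * (1 - t) * q"
      unfolding q_def power2_norm_eq_inner
      by (simp add: algebra_simps inner_commute)
    ultimately have "L / 2 * ((1 - t) * (norm yb)\<^sup>2 + t * (norm y)\<^sup>2 - t * (1 - t) * q) + g yb
        \<ge> (1 - t) * \<gamma> yb + t * \<gamma> y"
      by (simp add: g)
    then have "t * (g y + L / 2 * (1 - t) * q) \<le> t * g yb"
      by (simp add: g algebra_simps diff_divide_distrib)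
    with t show ?thesis
      by simp
  qed
  have "((\<lambda>t. g y + L / 2 * (1 - t) * q) \<longlongrightarrow> g y + L / 2 * (1 - 0) * q) (at_right 0)"
    by (intro tendsto_intros)
  moreover have "eventually (\<lambda>t. g y + L / 2 * (1 - t) * q \<le> g yb) (at_right 0)"
    using chord by (auto simp: eventually_at_right_field intro!: exI[of _ 1])
  ultimately have "g y + L / 2 * (1 - 0) * q \<le> g yb"
    by (rule tendsto_upperbound) simp
  then show ?thesis
    by (simp add: q_def)
qed

lemma saddle_point_minimax:
  fixes f :: "'a \<Rightarrow> 'b \<Rightarrow> 'c::complete_lattice"
  assumes yb: "yb \<in> Y"
    and right: "\<And>y. y \<in> Y \<Longrightarrow> f xb y \<le> f xb yb"
    and left: "\<And>x. f xb yb \<le> f x yb"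
  shows "(SUP y\<in>Y. INF x. f x y) = f xb yb" "(INF x. SUP y\<in>Y. f x y) = f xb yb"
proof -
  have "f xb yb \<le> (INF x. f x yb)"
    using left by (rule INF_greatest)
  also have "\<dots> \<le> (SUP y\<in>Y. INF x. f x y)"
    using yb by (rule SUP_upper)
  finally have lower: "f xb yb \<le> (SUP y\<in>Y. INF x. f x y)" .
  have "(INF x. SUP y\<in>Y. f x y) \<le> (SUP y\<in>Y. f xb y)"
    by (rule INF_lower) simp
  also have "\<dots> \<le> f xb yb"
    using right by (rule SUP_least)
  finally have upper: "(INF x. SUP y\<in>Y. f x y) \<le> f xb yb" .
  have weak: "(SUP y\<in>Y. INF x. f x y) \<le> (INF x. SUP y\<in>Y. f x y)"
    by (intro SUP_least INF_greatest) (meson INF_lower SUP_upper UNIV_I order_trans)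
  show "(SUP y\<in>Y. INF x. f x y) = f xb yb" "(INF x. SUP y\<in>Y. f x y) = f xb yb"
    using lower weak upper by (auto intro: order_antisym order_trans)
qed

theorem theorem2p5:
  fixes Y :: "(real ^ 'n) set"
    and \<gamma> J :: "real ^ 'n \<Rightarrow> real"
    and L :: real
    and f :: "real ^ 'n \<Rightarrow> real ^ 'n \<Rightarrow> real"
  assumes "Y \<noteq> {}" and "closed Y" and "convex Y"
    and "concave_on UNIV \<gamma>" and "continuous_on UNIV \<gamma>"
    and "\<And>x. J differentiable (at x)"
    and "filterlim J at_top at_infinity"
    and "\<And>x x'. norm (gradient J x - gradient J x') \<le> L * norm (x - x')"
    and "f = (\<lambda>x y. J (x + y) - L / 2 * (norm y)\<^sup>2 + \<gamma> y)"
  shows "(INF x. ereal (J x)) + (SUP y\<in>Y. ereal (- (L / 2) * (norm y)\<^sup>2 + \<gamma> y)) =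
           (INF x. SUP y\<in>Y. ereal (J (x + y) - L / 2 * (norm y)\<^sup>2 + \<gamma> y))
       \<and> (SUP y\<in>Y. INF x. ereal (f x y)) = (INF x. SUP y\<in>Y. ereal (f x y))
       \<and> (\<exists>xb. \<exists>yb\<in>Y. \<forall>x. \<forall>y\<in>Y. f xb y \<le> f xb yb \<and> f xb yb \<le> f x yb)"
proof -
  define g where "g y = - (L / 2) * (norm y)\<^sup>2 + \<gamma> y" for y
  have f: "f x y = J (x + y) + g y" for x y
    by (simp add: assms(9) g_def)
  have "continuous_on UNIV J"
    using assms(6) by (intro differentiable_imp_continuous_on differentiable_at_imp_differentiable_on)
  then obtain z where z: "\<And>x. J z \<le> J x"
    using coercive_attains_inf[of UNIV J] assms(7) by auto
  note J_upper = Lipschitz_gradient_upper_bound[OF assms(6,8) z]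
  have "L > 0"
  proof (rule ccontr)
    assume "\<not> L > 0"
    then have "J x \<le> J z" for x
      using J_upper[of "x - z"] mult_nonpos_nonneg[of L "(norm (x - z))\<^sup>2"] by simp
    moreover have "eventually (\<lambda>x. J x > J z) at_infinity"
      using assms(7) by (simp add: filterlim_at_top_dense)
    then obtain x where "J x > J z"
      using eventually_happens' trivial_limit_at_infinity by blast
    ultimately show False
      by (simp add: leD)
  qed
  from concave_minus_quadratic_coercive[OF assms(4,5) this]
  have "filterlim (\<lambda>y. - g y) at_top at_infinity"
    by (simp add: g_def)
  moreover have "continuous_on Y (\<lambda>y. - g y)"
    unfolding g_def by (intro continuous_intros continuous_on_subset[OF assms(5)]) auto
  ultimately obtain yb where yb: "yb \<in> Y" "\<And>y. y \<in> Y \<Longrightarrow> g y \<le> g yb"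
    using coercive_attains_inf[OF assms(1,2), of "\<lambda>y. - g y"] by auto
  have "concave_on Y \<gamma>"
    using assms(3,4) by (auto simp: concave_on_iff)
  note g_decay = strongly_concave_decay_from_maximizer[OF this yb(1) _ g_def yb(2)]
  define xb where "xb = z - yb"
  have right: "f xb y \<le> f xb yb" if "y \<in> Y" for y
    using J_upper[of "y - yb"] g_decay[OF that] by (simp add: f xb_def algebra_simps)
  have left: "f xb yb \<le> f x yb" for x
    using z by (simp add: f xb_def)
  have minimax: "(SUP y\<in>Y. INF x. ereal (f x y)) = ereal (f xb yb)"
    "(INF x. SUP y\<in>Y. ereal (f x y)) = ereal (f xb yb)"
    using saddle_point_minimax[of yb Y "\<lambda>x y. ereal (f x y)" xb] yb(1) right left by auto
  have "(INF x. ereal (J x)) = ereal (J z)"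
    using z by (intro antisym INF_lower INF_greatest) auto
  moreover have "(SUP y\<in>Y. ereal (g y)) = ereal (g yb)"
    using yb by (intro antisym SUP_upper SUP_least) auto
  ultimately have "(INF x. ereal (J x)) + (SUP y\<in>Y. ereal (g y)) = (INF x. SUP y\<in>Y. ereal (f x y))"
    by (simp only: minimax) (simp add: f xb_def)
  then have "(INF x. ereal (J x)) + (SUP y\<in>Y. ereal (- (L / 2) * (norm y)\<^sup>2 + \<gamma> y)) =
      (INF x. SUP y\<in>Y. ereal (J (x + y) - L / 2 * (norm y)\<^sup>2 + \<gamma> y))"
    unfolding assms(9) g_def .
  with minimax yb(1) right left show ?thesis
    by auto
qed

end
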